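(* Let $n\ge1$, $m\ge0$, let $F_n$ be the free group on $z_1,\dots,z_n$, let $V_m=(v_1,\dots,v_m)$ be a tuple of words in $F_n$, and let $N$ be the normal closure of $\{v_1,\dots,v_m\}$ in $F_n$. Let $a,b$ be words in $F_n$. Then $FTL_{s1}(F_n,V_m,a)$ and $FTL_{s1}(F_n,V_m,b)$ are Hurwitz equivalent if and only if there exists $Y\in N$ such that $a^Y=b$ in $F_n$.
   Context: Conjugation notation: $a^b=b^{-1}ab$. For a group $G_1\oplus G_2$, $R=(R_1,\dots,R_p)$, $W=(W_1,\dots,W_q)$, $H$ in $G_1$ and $X=(X_1,\dots,X_{q+2})$ in $G_2$, let $P_X(R,W,H)=((R_1,1),\dots,(R_p,1),(W_1,X_1),\dots,(W_q,X_q),(H^{-1},X_{q+1}),(H,X_{q+2}))$. Let $F_X$ be the free group on $X_1,\dots,X_{n+1}$, and fix an injective homomorphism $i:F_n\oplus F_X\to F_2\oplus F_2$ ($F_2$ the free group of rank 2). Define $FTL_{s1}(F_n,V_m,a)=i(P_X(V_f,W,a))$ where $V_f=(v_1,\dots,v_m,(v_1\cdots v_m)^{-1})$, $W=(z_1,\dots,z_n,(z_1\cdots z_n)^{-1})$, and $X=(X_1,\dots,X_n,(X_1\cdots X_n)^{-1},X_{n+1}^{-1},X_{n+1})$ (applying $i$ entrywise); this is a $1$-factorization in $F_2\oplus F_2$. The braid group acts on the right on tuples of group elements by $(f_1,\dots,f_k)\sigma_i=(\dots,f_{i-1},f_{i+1},f_{i+1}^{-1}f_if_{i+1},f_{i+2},\dots)$,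 $(f_1,\dots,f_k)\sigma_i^{-1}=(\dots,f_{i-1},f_if_{i+1}f_i^{-1},f_i,f_{i+2},\dots)$; Hurwitz equivalent means in the same orbit. *)

theory Defs
  imports "HOL-Algebra.Group" "HOL-Algebra.Coset"
begin

section \<open>Free groups\<close>

text \<open>
  The free group on a set is the group of reduced words. The letter \<open>(x, True)\<close> stands for
  the generator \<open>x\<close> and \<open>(x, False)\<close> for its inverse.
\<close>

type_synonym 'a letter = "'a \<times> bool"

definition inv_letter :: "'a letter \<Rightarrow> 'a letter" where
  "inv_letter g = (fst g, \<not> snd g)"

definition reduced :: "'a letter list \<Rightarrow> bool" where
  "reduced = successively (\<lambda>g h. h \<noteq> inv_letter g)"

fun cons_letter :: "'a letter \<Rightarrow> 'a letter list \<Rightarrow> 'a letter list" where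
  "cons_letter g [] = [g]"
| "cons_letter g (h # w) = (if h = inv_letter g then w else g # h # w)"

definition free_group :: "'a set \<Rightarrow> 'a letter list monoid" where
  "free_group S =
    \<lparr>carrier = {w. reduced w \<and> set w \<subseteq> S \<times> UNIV},
     mult = (\<lambda>u w. foldr cons_letter u w),
     one = []\<rparr>"

definition gen :: "'a \<Rightarrow> 'a letter list" where
  "gen x = [(x, True)]"

lemma inv_letter_inv_letter [simp]: "inv_letter (inv_letter g) = g"
  by (simp add: inv_letter_def)

lemma inv_letter_neq [simp]: "inv_letter g \<noteq> g" "g \<noteq> inv_letter g"
  by (auto simp: inv_letter_def prod_eq_iff)

lemma reduced_Nil [simp]: "reduced []"
  by (simp add: reduced_def)

lemma reduced_Cons: "reduced (g # w) \<longleftrightarrow> w = [] \<or> hd w \<noteq> inv_letter g \<and> reduced w"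
  by (auto simp: reduced_def successively_Cons)

lemma reduced_tl: "reduced (g # w) \<Longrightarrow> reduced w"
  by (auto simp: reduced_Cons)

lemma reduced_cons_letter: "reduced w \<Longrightarrow> reduced (cons_letter g w)"
  by (cases w) (auto simp: reduced_Cons)

lemma set_cons_letter: "set (cons_letter g w) \<subseteq> insert g (set w)"
  by (cases w) auto

lemma cons_letter_reduced: "reduced (g # w) \<Longrightarrow> cons_letter g w = g # w"
  by (cases w) (auto simp: reduced_Cons)

lemma cons_letter_cancel:
  assumes "reduced w"
  shows "cons_letter (inv_letter g) (cons_letter g w) = w"
proof (cases w)
  case (Cons h v)
  then show ?thesis
    using assms by (cases v) (auto simp: reduced_Cons)
qed simp

lemma reduced_foldr: "reduced w \<Longrightarrow> reduced (foldr cons_letter u w)"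
  by (induction u) (auto intro: reduced_cons_letter)

lemma set_foldr: "set (foldr cons_letter u w) \<subseteq> set u \<union> set w"
proof (induction u)
  case (Cons g u)
  then show ?case
    using set_cons_letter[of g "foldr cons_letter u w"] by auto
qed simp

lemma foldr_cons_letter_Nil: "reduced w \<Longrightarrow> foldr cons_letter w [] = w"
proof (induction w)
  case (Cons g w)
  then show ?case
    using reduced_tl[OF Cons.prems] cons_letter_reduced[OF Cons.prems] by simp
qed simp

lemma foldr_cons_letter:
  assumes "reduced w"
  shows "foldr cons_letter (cons_letter g u) w = cons_letter g (foldr cons_letter u w)"
proof (cases u)
  case (Cons h v)
  show ?thesis
  proof (cases "h = inv_letter g")
    case True
    have "cons_letter (inv_letter h) (cons_letter h (foldr cons_letter v w)) = foldr cons_letter v w"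
      by (rule cons_letter_cancel[OF reduced_foldr[OF assms]])
    with True Cons show ?thesis by simp
  qed (simp add: Cons)
qed simp

lemma foldr_cons_letter_assoc:
  assumes "reduced w"
  shows "foldr cons_letter (foldr cons_letter u v) w = foldr cons_letter u (foldr cons_letter v w)"
  by (induction u) (simp_all add: foldr_cons_letter[OF assms])

lemma foldr_cons_letter_inverse:
  "reduced w \<Longrightarrow> foldr cons_letter (foldr cons_letter (rev (map inv_letter w)) []) w = []"
proof -
  have "reduced w \<Longrightarrow> foldr cons_letter (rev (map inv_letter w)) w = []"
  proof (induction w)
    case (Cons g w)
    then show ?case
      using reduced_tl[OF Cons.prems] by simp
  qed simp
  then show "reduced w \<Longrightarrow> ?thesis"
    by (simp add: foldr_cons_letter_assoc)
qed

lemma group_free_group: "group (free_group S)"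
proof (rule groupI)
  fix u w assume "u \<in> carrier (free_group S)" "w \<in> carrier (free_group S)"
  then show "u \<otimes>\<^bsub>free_group S\<^esub> w \<in> carrier (free_group S)"
    using set_foldr[of u w] by (auto simp: free_group_def intro: reduced_foldr)
next
  fix w assume w: "w \<in> carrier (free_group S)"
  define v where "v = foldr cons_letter (rev (map inv_letter w)) []"
  have "set v \<subseteq> inv_letter ` set w"
    using set_foldr[of "rev (map inv_letter w)" "[]"] by (simp add: v_def)
  then have "v \<in> carrier (free_group S)"
    using w by (fastforce simp: free_group_def v_def inv_letter_def intro: reduced_foldr)
  moreover have "v \<otimes>\<^bsub>free_group S\<^esub> w = \<one>\<^bsub>free_group S\<^esub>"
    using w by (simp add: free_group_def v_def foldr_cons_letter_inverse)
  ultimately show "\<exists>v\<in>carrier (free_group S). v \<otimes>\<^bsub>free_group S\<^esub> w = \<one>\<^bsub>free_group S\<^esub>"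
    by blast
qed (auto simp: free_group_def foldr_cons_letter_assoc)

lemma gen_closed: "x \<in> S \<Longrightarrow> gen x \<in> carrier (free_group S)"
  by (simp add: free_group_def gen_def reduced_Cons)


section \<open>Conjugation, products and normal closure\<close>

definition conjugate :: "('a, 'b) monoid_scheme \<Rightarrow> 'a \<Rightarrow> 'a \<Rightarrow> 'a" where
  "conjugate G a b = inv\<^bsub>G\<^esub> b \<otimes>\<^bsub>G\<^esub> a \<otimes>\<^bsub>G\<^esub> b"

definition list_prod :: "('a, 'b) monoid_scheme \<Rightarrow> 'a list \<Rightarrow> 'a" where
  "list_prod G fs = foldr (\<otimes>\<^bsub>G\<^esub>) fs \<one>\<^bsub>G\<^esub>"

definition normal_closure :: "('a, 'b) monoid_scheme \<Rightarrow> 'a set \<Rightarrow> 'a set" where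
  "normal_closure G A = \<Inter> {K. K \<lhd> G \<and> A \<subseteq> K}"


section \<open>Hurwitz equivalence\<close>

text \<open>
  \<open>hurwitz_move G (i, True)\<close> is the action of \<open>\<sigma>\<^sub>i\<close> and \<open>hurwitz_move G (i, False)\<close> that of
  \<open>\<sigma>\<^sub>i\<^sup>-\<^sup>1\<close>. The index \<open>i\<close> counts from 1 as usual, whereas list positions count from 0: the
  entry \<open>f\<^sub>i\<close> is \<open>fs ! (i - 1)\<close>.
\<close>

fun hurwitz_move :: "('a, 'b) monoid_scheme \<Rightarrow> nat letter \<Rightarrow> 'a list \<Rightarrow> 'a list" where
  "hurwitz_move G (i, True) fs =
    fs[i - 1 := fs ! i,
       i := inv\<^bsub>G\<^esub> (fs ! i) \<otimes>\<^bsub>G\<^esub> fs ! (i - 1) \<otimes>\<^bsub>G\<^esub> fs ! i]"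
| "hurwitz_move G (i, False) fs =
    fs[i - 1 := fs ! (i - 1) \<otimes>\<^bsub>G\<^esub> fs ! i \<otimes>\<^bsub>G\<^esub> inv\<^bsub>G\<^esub> (fs ! (i - 1)),
       i := fs ! (i - 1)]"

text \<open>
  The right action of a word in the generators \<open>\<sigma>\<^sub>i\<^sup>\<plusminus>\<^sup>1\<close> of the braid group. Every element of the
  braid group on \<open>k\<close> strands is represented by a word in \<open>\<sigma>\<^sub>1\<^sup>\<plusminus>\<^sup>1, \<dots>, \<sigma>\<^sub>k\<^sub>-\<^sub>1\<^sup>\<plusminus>\<^sup>1\<close>,
  so two tuples are in the same orbit iff such a word takes one to the other.
\<close>

definition braid_act :: "('a, 'b) monoid_scheme \<Rightarrow> 'a list \<Rightarrow> nat letter list \<Rightarrow> 'a list" where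
  "braid_act G fs w = foldl (\<lambda>gs s. hurwitz_move G s gs) fs w"

definition hurwitz_equiv :: "('a, 'b) monoid_scheme \<Rightarrow> 'a list \<Rightarrow> 'a list \<Rightarrow> bool" where
  "hurwitz_equiv G fs gs \<longleftrightarrow>
    (\<exists>w. set w \<subseteq> {1..<length fs} \<times> UNIV \<and> braid_act G fs w = gs)"


section \<open>The factorizations\<close>

text \<open>\<open>P_tuple G1 G2 X R W H\<close> is $P_X(R,W,H)$; it is meant for \<open>length X = length W + 2\<close>.\<close>

definition P_tuple :: "('a, 'c) monoid_scheme \<Rightarrow> ('b, 'd) monoid_scheme \<Rightarrow>
    'b list \<Rightarrow> 'a list \<Rightarrow> 'a list \<Rightarrow> 'a \<Rightarrow> ('a \<times> 'b) list" where
  "P_tuple G1 G2 X R W H = map (\<lambda>r. (r, \<one>\<^bsub>G2\<^esub>)) R @ zip (W @ [inv\<^bsub>G1\<^esub> H, H]) X"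

text \<open>
  \<open>F n\<close> is the free group with basis \<open>gen 1, \<dots>, gen n\<close>. The basis elements play the role of
  \<open>z\<^sub>1, \<dots>, z\<^sub>n\<close> in \<open>F n\<close> and of \<open>X\<^sub>1, \<dots>, X\<^sub>n\<^sub>+\<^sub>1\<close> in \<open>F (n + 1)\<close>.
\<close>

abbreviation F :: "nat \<Rightarrow> nat letter list monoid" where
  "F n \<equiv> free_group {1..n}"

definition FTL_s1 :: "(nat letter list \<times> nat letter list \<Rightarrow> nat letter list \<times> nat letter list) \<Rightarrow>
    nat \<Rightarrow> nat letter list list \<Rightarrow> nat letter list \<Rightarrow> (nat letter list \<times> nat letter list) list" where
  "FTL_s1 \<iota> n V a =
    (let Vf = V @ [inv\<^bsub>F n\<^esub> (list_prod (F n) V)];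
         z = map gen [1..<n + 1];
         W = z @ [inv\<^bsub>F n\<^esub> (list_prod (F n) z)];
         x = map gen [1..<n + 1];
         X = x @ [inv\<^bsub>F (n + 1)\<^esub> (list_prod (F (n + 1)) x),
                  inv\<^bsub>F (n + 1)\<^esub> (gen (n + 1)), gen (n + 1)]
     in map \<iota> (P_tuple (F n) (F (n + 1)) X Vf W a))"

end

theory Submission
  imports Defs "HOL-Algebra.Elementary_Groups" "HOL-Algebra.Generated_Groups"
begin

text \<open>
  Since \<open>\<iota>\<close> is injective, everything happens in \<open>F n \<times>\<times> F (n + 1)\<close>.
  A pair \<open>(h\<^sup>-\<^sup>1, h)\<close> of adjacent entries has product 1, so it can be moved past its neighbours
  without changing them, and it can thereby be conjugated by every element of the subgroup
  generated by the other entries. Because each \<open>w\<close> in \<open>F n\<close> occurs there as a first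
  component, this subgroup contains \<open>(Y, 1)\<close> for every \<open>Y\<close> in the normal closure \<open>N\<close>.

  Conversely, let \<open>\<phi>\<close> be the homomorphism that maps \<open>X\<^sub>i\<close> to \<open>z\<^sub>i\<close> and \<open>X\<^sub>n\<^sub>+\<^sub>1\<close> to \<open>a\<close>. The entries
  lie in the subgroup \<open>T\<close> of all \<open>(p, q)\<close> with \<open>p \<in> N \<phi>(q)\<close>, so Hurwitz moves conjugate by elements
  of \<open>T\<close>. Counting exponents of \<open>X\<^sub>n\<^sub>+\<^sub>1\<close>, the entry \<open>(b, X\<^sub>n\<^sub>+\<^sub>1)\<close> can only be conjugate
  to \<open>(a, X\<^sub>n\<^sub>+\<^sub>1)\<close>. The second component of the conjugator centralizes \<open>X\<^sub>n\<^sub>+\<^sub>1\<close>, hence is a power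
  of it; after division by this power of \<open>(a, X\<^sub>n\<^sub>+\<^sub>1)\<close> the conjugator is \<open>(Y, 1)\<close> with \<open>Y \<in> N\<close>.
\<close>

section \<open>Hurwitz moves\<close>

text \<open>Displaying the two affected entries replaces index arithmetic by concatenation. The
  index is \<open>Suc (length us)\<close> because braid generators count from 1.\<close>

lemma hurwitz_move_True_append:
  "hurwitz_move G (Suc (length us), True) (us @ x # y # vs) = us @ y # (inv\<^bsub>G\<^esub> y \<otimes>\<^bsub>G\<^esub> x \<otimes>\<^bsub>G\<^esub> y) # vs"
  by (simp add: list_update_append nth_append)

lemma hurwitz_move_False_append:
  "hurwitz_move G (Suc (length us), False) (us @ x # y # vs) = us @ (x \<otimes>\<^bsub>G\<^esub> y \<otimes>\<^bsub>G\<^esub> inv\<^bsub>G\<^esub> x) # x # vs"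
  by (simp add: list_update_append nth_append)

lemma length_hurwitz_move [simp]: "length (hurwitz_move G s fs) = length fs"
  by (cases "(G, s, fs)" rule: hurwitz_move.cases) auto

lemma length_braid_act [simp]: "length (braid_act G fs w) = length fs"
  by (induction w rule: rev_induct) (auto simp: braid_act_def)

lemma hurwitz_equiv_refl [simp]: "hurwitz_equiv G fs fs"
  by (auto simp: hurwitz_equiv_def braid_act_def intro: exI[of _ "[]"])

lemma hurwitz_equiv_trans [trans]:
  assumes "hurwitz_equiv G fs gs" "hurwitz_equiv G gs hs"
  shows "hurwitz_equiv G fs hs"
proof -
  obtain v w where v: "set v \<subseteq> {1..<length fs} \<times> UNIV" "braid_act G fs v = gs"
    and w: "set w \<subseteq> {1..<length gs} \<times> UNIV" "braid_act G gs w = hs"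
    using assms unfolding hurwitz_equiv_def by blast
  moreover have "length gs = length fs"
    using v(2) by auto
  ultimately have "set (v @ w) \<subseteq> {1..<length fs} \<times> UNIV \<and> braid_act G fs (v @ w) = hs"
    by (auto simp: braid_act_def)
  then show ?thesis
    unfolding hurwitz_equiv_def by blast
qed

lemma hurwitz_equiv_right:
  "hurwitz_equiv G (us @ x # y # vs) (us @ y # (inv\<^bsub>G\<^esub> y \<otimes>\<^bsub>G\<^esub> x \<otimes>\<^bsub>G\<^esub> y) # vs)"
  unfolding hurwitz_equiv_def
  by (rule exI[of _ "[(Suc (length us), True)]"])
    (simp add: braid_act_def hurwitz_move_True_append del: hurwitz_move.simps)

lemma hurwitz_equiv_left:
  "hurwitz_equiv G (us @ x # y # vs) (us @ (x \<otimes>\<^bsub>G\<^esub> y \<otimes>\<^bsub>G\<^esub> inv\<^bsub>G\<^esub> x) # x # vs)"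
  unfolding hurwitz_equiv_def
  by (rule exI[of _ "[(Suc (length us), False)]"])
    (simp add: braid_act_def hurwitz_move_False_append del: hurwitz_move.simps)

text \<open>Reduces any invariant of an orbit to single moves on two adjacent entries, so that braid
  words need not appear again.\<close>

lemma hurwitz_equiv_induct [consumes 1, case_names base right left]:
  assumes "hurwitz_equiv G fs gs"
    and base: "P fs"
    and right: "\<And>us x y vs. P (us @ x # y # vs) \<Longrightarrow> P (us @ y # (inv\<^bsub>G\<^esub> y \<otimes>\<^bsub>G\<^esub> x \<otimes>\<^bsub>G\<^esub> y) # vs)"
    and left: "\<And>us x y vs. P (us @ x # y # vs) \<Longrightarrow> P (us @ (x \<otimes>\<^bsub>G\<^esub> y \<otimes>\<^bsub>G\<^esub> inv\<^bsub>G\<^esub> x) # x # vs)"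
  shows "P gs"
proof -
  have move: "P (hurwitz_move G (i, c) hs)" if "P hs" and i: "1 \<le> i" "i < length hs" for i c hs
  proof -
    \<comment> \<open>Generator \<open>i\<close> acts on list positions \<open>i - 1\<close> and
      \<open>i\<close>, so the untouched prefix has length \<open>i - 1\<close>.\<close>
    define us where "us = take (i - 1) hs"
    have hs: "hs = us @ hs ! (i - 1) # hs ! i # drop (i + 1) hs"
      using i id_take_nth_drop[of "i - 1" hs] Cons_nth_drop_Suc[of i hs] by (simp add: us_def)
    have "i = Suc (length us)"
      using i by (simp add: us_def)
    moreover obtain x y vs where "hs = us @ x # y # vs"
      using hs by blast
    ultimately show ?thesis
      using \<open>P hs\<close> right[of us x y vs] left[of us x y vs]
      by (cases c) (simp_all add: hurwitz_move_True_append hurwitz_move_False_append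
          del: hurwitz_move.simps)
  qed
  have "P (braid_act G fs w)" if "set w \<subseteq> {1..<length fs} \<times> UNIV" for w
    using that
  proof (induction w rule: rev_induct)
    case Nil
    then show ?case
      using base by (simp add: braid_act_def)
  next
    case (snoc s w)
    obtain i c where s: "s = (i, c)"
      by force
    have "braid_act G fs (w @ [s]) = hurwitz_move G (i, c) (braid_act G fs w)"
      by (simp add: braid_act_def s)
    then show ?case
      using snoc move[of "braid_act G fs w" i c] s by auto
  qed
  then show ?thesis
    using assms(1) unfolding hurwitz_equiv_def by blast
qed

section \<open>Transport of Hurwitz equivalence along homomorphisms\<close>

lemma (in group_hom) hurwitz_equiv_map:
  assumes "hurwitz_equiv G fs gs" "set fs \<subseteq> carrier G"
  shows "hurwitz_equiv H (map h fs) (map h gs)"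
proof -
  \<comment> \<open>Membership in the carrier is carried along because \<open>h\<close> respects
    products and inverses only there.\<close>
  have "set gs \<subseteq> carrier G \<and> hurwitz_equiv H (map h fs) (map h gs)"
    using assms(1)
  proof (induction rule: hurwitz_equiv_induct)
    case base
    then show ?case using assms(2) by simp
  next
    case (right us x y vs)
    then show ?case
      using hurwitz_equiv_trans hurwitz_equiv_right[of H "map h us" "h x" "h y" "map h vs"] by auto
  next
    case (left us x y vs)
    then show ?case
      using hurwitz_equiv_trans hurwitz_equiv_left[of H "map h us" "h x" "h y" "map h vs"] by auto
  qed
  then show ?thesis by simp
qed

text \<open>Every move on an image tuple lifts to a move on a preimage tuple. Hence the whole orbit
  consists of images, and injectivity identifies the lift with \<open>gs\<close>.\<close>

lemma (in group_hom) hurwitz_equiv_map_iff: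
  assumes inj: "inj_on h (carrier G)" and fs: "set fs \<subseteq> carrier G" and gs: "set gs \<subseteq> carrier G"
  shows "hurwitz_equiv H (map h fs) (map h gs) \<longleftrightarrow> hurwitz_equiv G fs gs"
proof
  assume "hurwitz_equiv H (map h fs) (map h gs)"
  then have "\<exists>hs. set hs \<subseteq> carrier G \<and> map h gs = map h hs \<and> hurwitz_equiv G fs hs"
  proof (induction rule: hurwitz_equiv_induct)
    case base
    then show ?case using fs by auto
  next
    case (right us x y vs)
    then obtain us' x' y' vs' where
      *: "set (us' @ x' # y' # vs') \<subseteq> carrier G" "hurwitz_equiv G fs (us' @ x' # y' # vs')"
      and "us = map h us'" "x = h x'" "y = h y'" "vs = map h vs'"
      by (force simp: map_eq_append_conv append_eq_map_conv Cons_eq_map_conv)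
    then show ?case
      using hurwitz_equiv_trans[OF *(2) hurwitz_equiv_right]
      by (intro exI[of _ "us' @ y' # (inv y' \<otimes> x' \<otimes> y') # vs'"]) auto
  next
    case (left us x y vs)
    then obtain us' x' y' vs' where
      *: "set (us' @ x' # y' # vs') \<subseteq> carrier G" "hurwitz_equiv G fs (us' @ x' # y' # vs')"
      and "us = map h us'" "x = h x'" "y = h y'" "vs = map h vs'"
      by (force simp: map_eq_append_conv append_eq_map_conv Cons_eq_map_conv)
    then show ?case
      using hurwitz_equiv_trans[OF *(2) hurwitz_equiv_left]
      by (intro exI[of _ "us' @ (x' \<otimes> y' \<otimes> inv x') # x' # vs'"]) auto
  qed
  then obtain hs where "set hs \<subseteq> carrier G" "map h gs = map h hs" "hurwitz_equiv G fs hs"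
    by blast
  moreover have "gs = hs"
    using calculation gs inj by (meson Un_subset_iff inj_on_map_eq_map inj_on_subset)
  ultimately show "hurwitz_equiv G fs gs" by simp
qed (rule hurwitz_equiv_map[OF _ fs])

section \<open>Conjugation and the movement of inverse pairs\<close>

context group
begin

lemma conjugate_closed [simp]:
  "\<lbrakk>x \<in> carrier G; g \<in> carrier G\<rbrakk> \<Longrightarrow> conjugate G x g \<in> carrier G"
  by (simp add: conjugate_def)

lemma conjugate_one [simp]: "x \<in> carrier G \<Longrightarrow> conjugate G x \<one> = x"
  by (simp add: conjugate_def)

lemma conjugate_mult:
  "\<lbrakk>x \<in> carrier G; g \<in> carrier G; h \<in> carrier G\<rbrakk>
    \<Longrightarrow> conjugate G x (g \<otimes> h) = conjugate G (conjugate G x g) h"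
  by (simp add: conjugate_def inv_mult_group m_assoc)

lemma inv_conjugate:
  "\<lbrakk>x \<in> carrier G; g \<in> carrier G\<rbrakk> \<Longrightarrow> inv (conjugate G x g) = conjugate G (inv x) g"
  by (simp add: conjugate_def inv_mult_group m_assoc)

lemma inv_mult_cancel_left: "\<lbrakk>x \<in> carrier G; y \<in> carrier G\<rbrakk> \<Longrightarrow> inv x \<otimes> (x \<otimes> y) = y"
  by (simp add: m_assoc[symmetric])

lemma list_prod_closed: "set fs \<subseteq> carrier G \<Longrightarrow> list_prod G fs \<in> carrier G"
  by (induction fs) (auto simp: list_prod_def)

lemma list_prod_in_subgroup: "subgroup K G \<Longrightarrow> set fs \<subseteq> K \<Longrightarrow> list_prod G fs \<in> K"
  by (induction fs) (auto simp: list_prod_def subgroup.one_closed subgroup.m_closed)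

text \<open>A move permutes two entries and conjugates one of them by the other or its inverse; the
  entries themselves never leave \<open>S\<close>, so neither do the accumulated
  conjugators.\<close>

lemma hurwitz_equiv_conjugate:
  assumes "hurwitz_equiv G fs gs" and S: "subgroup S G" "set fs \<subseteq> S" and "x \<in> set gs"
  shows "\<exists>y \<in> set fs. \<exists>g \<in> S. x = conjugate G y g"
proof -
  \<comment> \<open>Membership in \<open>S\<close> is part of the invariant, since any entry may
    conjugate its neighbour later.\<close>
  let ?C = "{x \<in> S. \<exists>y \<in> set fs. \<exists>g \<in> S. x = conjugate G y g}"
  have conj: "conjugate G x k \<in> ?C" if x: "x \<in> ?C" and k: "k \<in> S" for x k
  proof -
    obtain y g where y: "y \<in> set fs" "g \<in> S" "x = conjugate G y g"
      using x by blast
    then have "conjugate G x k = conjugate G y (g \<otimes> k)"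
      using k S subgroup.subset[OF S(1)] by (simp add: conjugate_mult subset_iff)
    moreover have "g \<otimes> k \<in> S" "conjugate G x k \<in> S"
      using x y k S(1) by (auto simp: conjugate_def subgroup.m_closed subgroup.m_inv_closed)
    ultimately show ?thesis
      using y(1) by blast
  qed
  have "set gs \<subseteq> ?C"
    using assms(1)
  proof (induction rule: hurwitz_equiv_induct)
    case base
    have "x = conjugate G x \<one>" if "x \<in> set fs" for x
      using that S subgroup.subset[OF S(1)] by (simp add: subset_iff)
    then show ?case
      using S subgroup.one_closed[OF S(1)] by blast
  next
    case (right us x y vs)
    then show ?case
      using conj[of x y] by (auto simp: conjugate_def)
  next
    case (left us x y vs)
    then have "x \<in> S" "y \<in> ?C" by auto
    then have "x \<otimes> y \<otimes> inv x \<in> ?C"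
      using conj[of y "inv x"] S(1) subgroup.mem_carrier[OF S(1)]
      by (simp add: conjugate_def subgroup.m_inv_closed)
    then show ?case
      using left by auto
  qed
  then show ?thesis
    using \<open>x \<in> set gs\<close> by blast
qed

text \<open>Passing \<open>inv h\<close> and then \<open>h\<close> conjugates \<open>g\<close> by
  mutually inverse elements, so the two effects cancel.\<close>

lemma hurwitz_equiv_pair_left:
  assumes "g \<in> carrier G" "h \<in> carrier G"
  shows "hurwitz_equiv G (us @ g # inv h # h # vs) (us @ inv h # h # g # vs)"
proof -
  have "hurwitz_equiv G (us @ g # inv h # h # vs) (us @ inv h # (h \<otimes> g \<otimes> inv h) # h # vs)"
    using hurwitz_equiv_right[of G us g "inv h" "h # vs"] assms by simp
  also have "hurwitz_equiv G \<dots> (us @ inv h # h # g # vs)"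
    using hurwitz_equiv_right[of G "us @ [inv h]" "h \<otimes> g \<otimes> inv h" h vs] assms
    by (simp add: m_assoc inv_mult_cancel_left)
  finally show ?thesis .
qed

lemma hurwitz_equiv_pair_right:
  assumes "g \<in> carrier G" "h \<in> carrier G"
  shows "hurwitz_equiv G (us @ inv h # h # g # vs) (us @ g # inv h # h # vs)"
proof -
  have "hurwitz_equiv G (us @ inv h # h # g # vs) (us @ inv h # (h \<otimes> g \<otimes> inv h) # h # vs)"
    using hurwitz_equiv_left[of G "us @ [inv h]" h g vs] by simp
  also have "hurwitz_equiv G \<dots> (us @ g # inv h # h # vs)"
    using hurwitz_equiv_left[of G us "inv h" "h \<otimes> g \<otimes> inv h" "h # vs"] assms
    by (simp add: m_assoc inv_mult_cancel_left)
  finally show ?thesis .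
qed

lemma hurwitz_equiv_pair_left_list:
  assumes "set fs \<subseteq> carrier G" "h \<in> carrier G"
  shows "hurwitz_equiv G (us @ fs @ inv h # h # vs) (us @ inv h # h # fs @ vs)"
  using assms
proof (induction fs arbitrary: us)
  case (Cons g fs)
  have "hurwitz_equiv G (us @ (g # fs) @ inv h # h # vs) (us @ g # inv h # h # fs @ vs)"
    using Cons.IH[of "us @ [g]"] Cons.prems by simp
  also have "hurwitz_equiv G \<dots> (us @ inv h # h # (g # fs) @ vs)"
    using hurwitz_equiv_pair_left[of g h us "fs @ vs"] Cons.prems by simp
  finally show ?case .
qed simp

lemma hurwitz_equiv_pair_right_list:
  assumes "set fs \<subseteq> carrier G" "h \<in> carrier G"
  shows "hurwitz_equiv G (us @ inv h # h # fs @ vs) (us @ fs @ inv h # h # vs)"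
  using assms
proof (induction fs arbitrary: us)
  case (Cons g fs)
  have "hurwitz_equiv G (us @ inv h # h # (g # fs) @ vs) (us @ g # inv h # h # fs @ vs)"
    using hurwitz_equiv_pair_right[of g h us "fs @ vs"] Cons.prems by simp
  also have "hurwitz_equiv G \<dots> (us @ (g # fs) @ inv h # h # vs)"
    using Cons.IH[of "us @ [g]"] Cons.prems by simp
  finally show ?case .
qed simp

text \<open>Here the opposite choice of crossings is made: \<open>g\<close> passes unchanged and
  both members of the pair absorb a conjugation.\<close>

lemma hurwitz_equiv_pair_conj_right:
  assumes "g \<in> carrier G" "h \<in> carrier G"
  shows "hurwitz_equiv G (us @ inv h # h # g # vs)
    (us @ g # inv (conjugate G h g) # conjugate G h g # vs)"
proof -
  have "hurwitz_equiv G (us @ inv h # h # g # vs) (us @ inv h # g # conjugate G h g # vs)"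
    using hurwitz_equiv_right[of G "us @ [inv h]" h g vs] by (simp add: conjugate_def)
  also have "hurwitz_equiv G \<dots> (us @ g # conjugate G (inv h) g # conjugate G h g # vs)"
    using hurwitz_equiv_right[of G us "inv h" g] by (simp add: conjugate_def)
  finally show ?thesis
    using assms by (simp add: inv_conjugate)
qed

lemma hurwitz_equiv_pair_conj_left:
  assumes "g \<in> carrier G" "h \<in> carrier G"
  shows "hurwitz_equiv G (us @ g # inv h # h # vs)
    (us @ inv (conjugate G h (inv g)) # conjugate G h (inv g) # g # vs)"
proof -
  have "hurwitz_equiv G (us @ g # inv h # h # vs) (us @ conjugate G (inv h) (inv g) # g # h # vs)"
    using hurwitz_equiv_left[of G us g "inv h" "h # vs"] assms by (simp add: conjugate_def)
  also have "hurwitz_equiv G \<dots> (us @ conjugate G (inv h) (inv g) # conjugate G h (inv g) # g # vs)"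
    using hurwitz_equiv_left[of G "us @ [conjugate G (inv h) (inv g)]" g h vs] assms
    by (simp add: conjugate_def)
  finally show ?thesis
    using assms by (simp add: inv_conjugate)
qed

text \<open>The pair can be brought next to any entry of \<open>fs\<close>, conjugated by it or its
  inverse, and returned with \<open>fs\<close> restored. Words in the entries follow by
  iteration.\<close>

lemma hurwitz_equiv_conjugate_pair:
  assumes g: "g \<in> generate G (set fs)" and fs: "set fs \<subseteq> carrier G" and "h \<in> carrier G"
  shows "hurwitz_equiv G (fs @ [inv h, h]) (fs @ [inv (conjugate G h g), conjugate G h g])"
  using g \<open>h \<in> carrier G\<close>
\<comment> \<open>\<open>h\<close> must vary: for a product the second conjugation starts from
  \<open>conjugate G h g1\<close>.\<close>
proof (induction arbitrary: h)
  case one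
  then show ?case by simp
next
  case (incl g)
  then obtain us vs where split: "fs = us @ g # vs"
    by (meson split_list)
  then have *: "set us \<subseteq> carrier G" "set vs \<subseteq> carrier G" "g \<in> carrier G"
    using fs by auto
  let ?k = "conjugate G h g"
  \<comment> \<open>The pair first travels left past \<open>vs\<close> and \<open>g\<close>
    unchanged; only the crossing of \<open>g\<close> on the way back conjugates it.\<close>
  have "hurwitz_equiv G (us @ g # vs @ [inv h, h]) (us @ g # inv h # h # vs)"
    using hurwitz_equiv_pair_left_list[of vs h "us @ [g]" "[]"] * incl by simp
  also have "hurwitz_equiv G \<dots> (us @ inv h # h # g # vs)"
    using * incl by (intro hurwitz_equiv_pair_left)
  also have "hurwitz_equiv G \<dots> (us @ g # inv ?k # ?k # vs)"
    using * incl by (intro hurwitz_equiv_pair_conj_right)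
  also have "hurwitz_equiv G \<dots> (us @ g # vs @ [inv ?k, ?k])"
    using hurwitz_equiv_pair_right_list[of vs ?k "us @ [g]" "[]"] * incl by simp
  finally show ?case
    using split by simp
next
  case (inv g)
  then obtain us vs where split: "fs = us @ g # vs"
    by (meson split_list)
  then have *: "set us \<subseteq> carrier G" "set vs \<subseteq> carrier G" "g \<in> carrier G"
    using fs by auto
  let ?k = "conjugate G h (inv g)"
  have "hurwitz_equiv G (us @ g # vs @ [inv h, h]) (us @ g # inv h # h # vs)"
    using hurwitz_equiv_pair_left_list[of vs h "us @ [g]" "[]"] * inv by simp
  \<comment> \<open>For an inverse the roles are exchanged: the crossing to the left conjugates, and
    the return changes nothing.\<close>
  also have "hurwitz_equiv G \<dots> (us @ inv ?k # ?k # g # vs)"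
    using * inv by (intro hurwitz_equiv_pair_conj_left)
  also have "hurwitz_equiv G \<dots> (us @ g # inv ?k # ?k # vs)"
    using * inv by (intro hurwitz_equiv_pair_right) auto
  also have "hurwitz_equiv G \<dots> (us @ g # vs @ [inv ?k, ?k])"
    using hurwitz_equiv_pair_right_list[of vs ?k "us @ [g]" "[]"] * inv by simp
  finally show ?case
    using split by simp
next
  case (eng g1 g2)
  have "g1 \<in> carrier G" "g2 \<in> carrier G"
    using eng.hyps generate_incl[OF fs] by auto
  then show ?case
    using eng hurwitz_equiv_trans[OF eng.IH(1)[of h] eng.IH(2)[of "conjugate G h g1"]]
    by (simp add: conjugate_mult)
qed

end

section \<open>Free groups\<close>

lemma free_group_simps:
  "carrier (free_group S) = {w. reduced w \<and> set w \<subseteq> S \<times> UNIV}"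
  "u \<otimes>\<^bsub>free_group S\<^esub> w = foldr cons_letter u w"
  "\<one>\<^bsub>free_group S\<^esub> = []"
  by (simp_all add: free_group_def)

lemma letter_inverse_gen:
  assumes "x \<in> S"
  shows "inv\<^bsub>free_group S\<^esub> (gen x) = [(x, False)]"
proof -
  interpret group "free_group S" by (rule group_free_group)
  show ?thesis
    using assms by (intro inv_equality)
      (auto simp: free_group_simps gen_def reduced_Cons inv_letter_def)
qed

lemma subgroup_free_group_contains:
  assumes K: "subgroup K (free_group S)" and gens: "gen ` S \<subseteq> K"
  shows "carrier (free_group S) \<subseteq> K"
proof
  fix w assume "w \<in> carrier (free_group S)"
  then show "w \<in> K"
  proof (induction w)
    case Nil
    then show ?case
      using subgroup.one_closed[OF K] by (simp add: free_group_simps)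
  next
    case (Cons l w)
    obtain x c where l: "l = (x, c)" by force
    have red: "reduced (l # w)" and x: "x \<in> S"
      using Cons.prems l by (auto simp: free_group_simps)
    have "w \<in> K"
      using Cons reduced_tl[OF red] by (auto simp: free_group_simps)
    moreover have "[l] \<in> K"
    proof (cases c)
      case True
      then show ?thesis
        using gens x l by (auto simp: gen_def)
    next
      case False
      then show ?thesis
        using gens x l subgroup.m_inv_closed[OF K, of "gen x"] letter_inverse_gen[OF x] by auto
    qed
    ultimately have "[l] \<otimes>\<^bsub>free_group S\<^esub> w \<in> K"
      using subgroup.m_closed[OF K] by blast
    then show ?case
      by (simp add: free_group_simps cons_letter_reduced[OF red])
  qed
qed

section \<open>Universal property of free groups\<close>

definition letter_eval :: "('b, 'c) monoid_scheme \<Rightarrow> ('a \<Rightarrow> 'b) \<Rightarrow> 'a letter \<Rightarrow> 'b" where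
  "letter_eval G f l = (if snd l then f (fst l) else inv\<^bsub>G\<^esub> (f (fst l)))"

text \<open>This is the homomorphism extending \<open>f\<close> from the generators; the formula
  makes sense for unreduced words as well.\<close>

definition word_eval :: "('b, 'c) monoid_scheme \<Rightarrow> ('a \<Rightarrow> 'b) \<Rightarrow> 'a letter list \<Rightarrow> 'b" where
  "word_eval G f w = list_prod G (map (letter_eval G f) w)"

context group
begin

context
  fixes f :: "'x \<Rightarrow> 'a" and S :: "'x set"
  assumes f: "f ` S \<subseteq> carrier G"
begin

lemma letter_eval_closed: "l \<in> S \<times> UNIV \<Longrightarrow> letter_eval G f l \<in> carrier G"
  using f by (auto simp: letter_eval_def)

lemma word_eval_closed: "set w \<subseteq> S \<times> UNIV \<Longrightarrow> word_eval G f w \<in> carrier G"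
  using letter_eval_closed unfolding word_eval_def by (intro list_prod_closed) auto

text \<open>If \<open>cons_letter\<close> cancels, the two lost letters have mutually inverse
  values; otherwise it merely prepends.\<close>

lemma word_eval_cons_letter:
  assumes "l \<in> S \<times> UNIV" "set w \<subseteq> S \<times> UNIV"
  shows "word_eval G f (cons_letter l w) = letter_eval G f l \<otimes> word_eval G f w"
proof (cases "\<exists>v. w = inv_letter l # v")
  case True
  then obtain v where w: "w = inv_letter l # v" by blast
  have "word_eval G f v \<in> carrier G"
    using assms w by (intro word_eval_closed) auto
  moreover have "letter_eval G f l \<in> carrier G"
    by (rule letter_eval_closed[OF assms(1)])
  moreover have "letter_eval G f (inv_letter l) = inv (letter_eval G f l)"
    using assms(1) f by (auto simp: letter_eval_def inv_letter_def)
  ultimately show ?thesis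
    unfolding w by (simp add: word_eval_def list_prod_def m_assoc[symmetric])
next
  case False
  then have "cons_letter l w = l # w"
    by (cases w) auto
  then show ?thesis
    by (simp add: word_eval_def list_prod_def)
qed

lemma word_eval_hom: "word_eval G f \<in> hom (free_group S) G"
proof (rule homI)
  fix u w assume "u \<in> carrier (free_group S)" "w \<in> carrier (free_group S)"
  then have uw: "set u \<subseteq> S \<times> UNIV" "set w \<subseteq> S \<times> UNIV"
    by (auto simp: free_group_simps)
  have "word_eval G f (foldr cons_letter u w) = word_eval G f u \<otimes> word_eval G f w"
    using uw(1)
  proof (induction u)
    case Nil
    then show ?case
      using word_eval_closed[OF uw(2)] by (simp add: word_eval_def list_prod_def)
  next
    case (Cons l u)
    have "set (foldr cons_letter u w) \<subseteq> S \<times> UNIV"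
      using set_foldr[of u w] uw(2) Cons.prems by auto
    then have "word_eval G f (foldr cons_letter (l # u) w)
        = letter_eval G f l \<otimes> (word_eval G f u \<otimes> word_eval G f w)"
      using Cons by (simp add: word_eval_cons_letter)
    also have "\<dots> = word_eval G f (l # u) \<otimes> word_eval G f w"
      using Cons.prems uw(2) letter_eval_closed[of l] word_eval_closed[of u] word_eval_closed[of w]
      by (simp add: word_eval_def list_prod_def m_assoc)
    finally show ?case .
  qed
  then show "word_eval G f (u \<otimes>\<^bsub>free_group S\<^esub> w) = word_eval G f u \<otimes> word_eval G f w"
    by (simp add: free_group_simps)
qed (auto simp: free_group_simps intro: word_eval_closed)

lemma word_eval_gen: "x \<in> S \<Longrightarrow> word_eval G f (gen x) = f x"
  using f by (auto simp: word_eval_def gen_def list_prod_def letter_eval_def)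

end

end

section \<open>Right multiplication by a letter and the centralizer of a generator\<close>

lemma foldr_cons_letter_singleton:
  "reduced w \<Longrightarrow> foldr cons_letter w [l] =
    (if w \<noteq> [] \<and> last w = inv_letter l then butlast w else w @ [l])"
proof (induction w)
  case (Cons k w)
  have w: "reduced w"
    using Cons.prems by (rule reduced_tl)
  show ?case
  proof (cases w)
    case Nil
    then show ?thesis
      by (auto simp: inv_letter_def prod_eq_iff)
  next
    case (Cons j v)
    \<comment> \<open>The letters \<open>k\<close> and \<open>j\<close> do not cancel, so
      \<open>k\<close> survives in front of whatever follows \<open>j\<close>.\<close>
    then have "cons_letter k (j # u) = k # j # u" for u
      using \<open>reduced (k # w)\<close> by (simp add: reduced_Cons)
    moreover have "v = [] \<Longrightarrow> j = inv_letter l \<Longrightarrow> cons_letter k [] = [k]"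
      by simp
    ultimately show ?thesis
      using Cons.IH[OF w] Cons by auto
  qed
qed simp

text \<open>Induction on the reduced word: its first letter must be \<open>gen x\<close> or its
  inverse, and stripping that letter leaves a shorter word that still commutes with
  \<open>gen x\<close>.\<close>

lemma centralizer_gen:
  assumes x: "x \<in> S" and "w \<in> carrier (free_group S)"
    and "gen x \<otimes>\<^bsub>free_group S\<^esub> w = w \<otimes>\<^bsub>free_group S\<^esub> gen x"
  shows "\<exists>k::int. w = gen x [^]\<^bsub>free_group S\<^esub> k"
  using assms(2,3)
proof (induction w)
  case Nil
  then show ?case
    by (auto simp: free_group_simps int_pow_def nat_pow_def intro: exI[of _ 0])
next
  case (Cons l w)
  interpret group "free_group S" by (rule group_free_group)
  let ?F = "free_group S"
  have red: "reduced (l # w)"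
    using Cons.prems by (simp add: free_group_simps)
  have gx: "gen x \<in> carrier ?F"
    by (rule gen_closed[OF x])
  have w: "w \<in> carrier ?F" and l: "[l] \<in> carrier ?F"
    using Cons.prems reduced_tl by (auto simp: free_group_simps reduced_Cons)
  have lw: "l # w = [l] \<otimes>\<^bsub>?F\<^esub> w"
    by (simp add: free_group_simps cons_letter_reduced[OF red])
  consider "l = (x, True)" | "l = (x, False)" | "fst l \<noteq> x"
    by (cases l) auto
  then show ?case
  proof cases
    case 3
    \<comment> \<open>Nothing cancels on the left, so the product has two letters more than
      \<open>w\<close> and starts with \<open>(x, True)\<close>. Right multiplication either gives a
      shorter word or one starting with \<open>l\<close>.\<close>
    have "foldr cons_letter (l # w) [(x, True)] = (x, True) # l # w"
      using Cons.prems(2) 3 by (auto simp: free_group_simps gen_def inv_letter_def split: if_splits)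
    then have False
      using 3 unfolding foldr_cons_letter_singleton[OF red]
      by (auto split: if_splits dest: arg_cong[of _ _ length])
    then show ?thesis ..
  next
    case 1
    then have l': "[l] = gen x [^]\<^bsub>?F\<^esub> (1::int)"
      using gx by (simp add: gen_def int_pow_1)
    have "gen x \<otimes>\<^bsub>?F\<^esub> (gen x \<otimes>\<^bsub>?F\<^esub> w) = gen x \<otimes>\<^bsub>?F\<^esub> (w \<otimes>\<^bsub>?F\<^esub> gen x)"
      using Cons.prems(2) gx w unfolding lw l' by (simp add: m_assoc)
    then have "gen x \<otimes>\<^bsub>?F\<^esub> w = w \<otimes>\<^bsub>?F\<^esub> gen x"
      using gx w by simp
    then obtain k :: int where "w = gen x [^]\<^bsub>?F\<^esub> k"
      using Cons.IH w by blast
    then show ?thesis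
      unfolding lw l' using gx by (metis int_pow_mult)
  next
    case 2
    then have l': "[l] = inv\<^bsub>?F\<^esub> (gen x)"
      by (simp add: letter_inverse_gen[OF x])
    have "w = (inv\<^bsub>?F\<^esub> (gen x) \<otimes>\<^bsub>?F\<^esub> w) \<otimes>\<^bsub>?F\<^esub> gen x"
      using Cons.prems(2) gx w unfolding lw l' by (simp add: m_assoc[symmetric])
    then have "gen x \<otimes>\<^bsub>?F\<^esub> w = w \<otimes>\<^bsub>?F\<^esub> gen x"
      using gx w by (metis inv_closed inv_solve_left m_assoc m_closed)
    then obtain k :: int where "w = gen x [^]\<^bsub>?F\<^esub> k"
      using Cons.IH w by blast
    moreover have "inv\<^bsub>?F\<^esub> (gen x) = gen x [^]\<^bsub>?F\<^esub> (-1::int)"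
      using gx by (simp add: int_pow_neg int_pow_1)
    ultimately show ?thesis
      unfolding lw l' using gx by (metis int_pow_mult)
  qed
qed

section \<open>Normal closures, equalizers and products of pairs\<close>

lemma (in group) normal_closure_normal:
  assumes "A \<subseteq> carrier G"
  shows "normal_closure G A \<lhd> G"
proof (rule normal_invI)
  show "subgroup (normal_closure G A) G"
    unfolding normal_closure_def
  proof (rule subgroups_Inter)
    \<comment> \<open>The carrier witnesses that the intersected family is nonempty.\<close>
    have "carrier G \<lhd> G"
      by (intro normal_invI subgroup_self) auto
    then show "{K. K \<lhd> G \<and> A \<subseteq> K} \<noteq> {}"
      using assms by blast
  qed (auto dest: normal_imp_subgroup)
qed (auto simp: normal_closure_def normal_inv_iff)

lemma normal_closure_subset: "A \<subseteq> normal_closure G A"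
  by (auto simp: normal_closure_def)

lemma normal_closure_least: "\<lbrakk>K \<lhd> G; A \<subseteq> K\<rbrakk> \<Longrightarrow> normal_closure G A \<subseteq> K"
  by (auto simp: normal_closure_def)


text \<open>Supplies the subgroups that confine the entries of a factorization: those of exponent
  zero, and the pairs whose coordinates agree modulo the normal closure.\<close>

lemma (in group) subgroup_equalizer:
  assumes "group H" "f \<in> hom G H" "g \<in> hom G H"
  shows "subgroup {x \<in> carrier G. f x = g x} G"
proof -
  interpret f: group_hom G H f
    using assms by (simp add: group_hom_def group_hom_axioms_def group_axioms)
  interpret g: group_hom G H g
    using assms by (simp add: group_hom_def group_hom_axioms_def group_axioms)
  show ?thesis
    by (rule subgroupI) auto
qed

lemma list_prod_DirProd:
  "list_prod (G \<times>\<times> H) (map (\<lambda>i. (f i, g i)) is) = (list_prod G (map f is), list_prod H (map g is))"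
  by (induction "is") (auto simp: list_prod_def)

section \<open>The factorizations\<close>

text \<open>Keeps the simplifier from rewriting \<open>F (n + 1)\<close> to \<open>F (Suc n)\<close>, where facts about the former no longer match.\<close>

declare One_nat_def [simp del]

text \<open>The part of the factorization that is independent of \<open>a\<close>, taken before
  \<open>\<iota>\<close> is applied.\<close>

definition FTL_front :: "nat \<Rightarrow> nat letter list list \<Rightarrow> (nat letter list \<times> nat letter list) list" where
  "FTL_front n V =
    map (\<lambda>r. (r, \<one>\<^bsub>F (n + 1)\<^esub>)) (V @ [inv\<^bsub>F n\<^esub> (list_prod (F n) V)])
    @ map (\<lambda>i. (gen i, gen i)) [1..<n + 1]
    @ [(inv\<^bsub>F n\<^esub> (list_prod (F n) (map gen [1..<n + 1])),
        inv\<^bsub>F (n + 1)\<^esub> (list_prod (F (n + 1)) (map gen [1..<n + 1])))]"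

lemma FTL_s1_eq:
  assumes "a \<in> carrier (F n)"
  shows "FTL_s1 \<iota> n V a = map \<iota> (FTL_front n V @
    [inv\<^bsub>F n \<times>\<times> F (n + 1)\<^esub> (a, gen (n + 1)), (a, gen (n + 1))])"
proof -
  have "inv\<^bsub>F n \<times>\<times> F (n + 1)\<^esub> (a, gen (n + 1)) = (inv\<^bsub>F n\<^esub> a, inv\<^bsub>F (n + 1)\<^esub> (gen (n + 1)))"
    using assms by (intro inv_DirProd group_free_group gen_closed) auto
  then show ?thesis
    by (simp add: FTL_s1_def P_tuple_def FTL_front_def Let_def zip_append zip_map_map
        zip_same_conv_map del: upt_Suc)
qed

lemma gens_in_FTL_front: "i \<in> {1..n} \<Longrightarrow> (gen i, gen i) \<in> set (FTL_front n V)"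
  by (auto simp: FTL_front_def)

lemma relators_in_FTL_front: "v \<in> set V \<Longrightarrow> (v, \<one>\<^bsub>F (n + 1)\<^esub>) \<in> set (FTL_front n V)"
  by (auto simp: FTL_front_def)

text \<open>The two remaining entries are inverses of products of relator entries and of generator
  entries, so a subgroup containing the latter contains everything.\<close>

lemma FTL_front_subset:
  assumes T: "subgroup T (F n \<times>\<times> F (n + 1))" and V: "set V \<subseteq> carrier (F n)"
    and rels: "\<And>v. v \<in> set V \<Longrightarrow> (v, \<one>\<^bsub>F (n + 1)\<^esub>) \<in> T"
    and gens: "\<And>i. i \<in> {1..n} \<Longrightarrow> (gen i, gen i) \<in> T"
  shows "set (FTL_front n V) \<subseteq> T"
proof -
  let ?D = "F n \<times>\<times> F (n + 1)"
  interpret F1: group "F n" by (rule group_free_group)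
  interpret F2: group "F (n + 1)" by (rule group_free_group)
  interpret D: group ?D by (intro DirProd_group group_free_group)
  \<comment> \<open>A common index list treats both closing entries at once: it is \<open>V\<close>
    for the relators and \<open>[1..<n + 1]\<close> for the generators.\<close>
  have inv_prod: "(inv\<^bsub>F n\<^esub> (list_prod (F n) (map f is)), inv\<^bsub>F (n + 1)\<^esub> (list_prod (F (n + 1)) (map g is))) \<in> T"
    if "\<And>i. i \<in> set is \<Longrightarrow> (f i, g i) \<in> T" for f g and "is" :: "'x list"
  proof -
    have "(f i, g i) \<in> carrier ?D" if "i \<in> set is" for i
      using \<open>\<And>i. i \<in> set is \<Longrightarrow> (f i, g i) \<in> T\<close>[OF that] subgroup.mem_carrier[OF T] by blast
    then have "list_prod (F n) (map f is) \<in> carrier (F n)"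
      "list_prod (F (n + 1)) (map g is) \<in> carrier (F (n + 1))"
      by (intro F1.list_prod_closed F2.list_prod_closed; force)+
    moreover have "list_prod ?D (map (\<lambda>i. (f i, g i)) is) \<in> T"
      using that by (intro D.list_prod_in_subgroup[OF T]) auto
    ultimately show ?thesis
      using subgroup.m_inv_closed[OF T, of "list_prod ?D (map (\<lambda>i. (f i, g i)) is)"]
      by (simp add: list_prod_DirProd inv_DirProd[OF group_free_group group_free_group])
  qed
  have "list_prod (F (n + 1)) (map (\<lambda>_. \<one>\<^bsub>F (n + 1)\<^esub>) V) = \<one>\<^bsub>F (n + 1)\<^esub>"
    by (induction V) (auto simp: list_prod_def)
  then have "(inv\<^bsub>F n\<^esub> (list_prod (F n) V), \<one>\<^bsub>F (n + 1)\<^esub>) \<in> T"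
    using inv_prod[of V "\<lambda>v. v" "\<lambda>_. \<one>\<^bsub>F (n + 1)\<^esub>"] rels by simp
  moreover have "(inv\<^bsub>F n\<^esub> (list_prod (F n) (map gen [1..<n + 1])),
      inv\<^bsub>F (n + 1)\<^esub> (list_prod (F (n + 1)) (map gen [1..<n + 1]))) \<in> T"
    using gens by (intro inv_prod) auto
  ultimately show ?thesis
    using rels gens unfolding FTL_front_def by (auto simp del: upt_Suc)
qed

lemma FTL_front_closed:
  assumes "set V \<subseteq> carrier (F n)"
  shows "set (FTL_front n V) \<subseteq> carrier (F n \<times>\<times> F (n + 1))"
proof (rule FTL_front_subset)
  show "subgroup (carrier (F n \<times>\<times> F (n + 1))) (F n \<times>\<times> F (n + 1))"
    by (intro group.subgroup_self DirProd_group group_free_group)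
qed (use assms in \<open>auto intro!: gen_closed monoid.one_closed group.is_monoid group_free_group\<close>)

text \<open>The elements \<open>p\<close> with \<open>(p, 1)\<close> in the generated subgroup
  contain the relators and form a normal subgroup, because every \<open>w\<close> in
  \<open>F n\<close> is the first coordinate of some generated pair.\<close>

lemma normal_closure_in_generate_FTL_front:
  assumes V: "set V \<subseteq> carrier (F n)" and Y: "Y \<in> normal_closure (F n) (set V)"
  shows "(Y, \<one>\<^bsub>F (n + 1)\<^esub>) \<in> generate (F n \<times>\<times> F (n + 1)) (set (FTL_front n V))"
proof -
  let ?D = "F n \<times>\<times> F (n + 1)" and ?A = "set (FTL_front n V)"
  interpret F1: group "F n" by (rule group_free_group)
  interpret F2: group "F (n + 1)" by (rule group_free_group)
  interpret D: group ?D by (intro DirProd_group group_free_group)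
  have E: "subgroup (generate ?D ?A) ?D"
    by (rule D.generate_is_subgroup[OF FTL_front_closed[OF V]])
  note invD = inv_DirProd[OF group_free_group group_free_group]
  have mult: "(p \<otimes>\<^bsub>F n\<^esub> p', q \<otimes>\<^bsub>F (n + 1)\<^esub> q') \<in> generate ?D ?A"
    if "(p, q) \<in> generate ?D ?A" "(p', q') \<in> generate ?D ?A" for p q p' q'
    using subgroup.m_closed[OF E that] by simp
  have inv: "p \<in> carrier (F n) \<and> q \<in> carrier (F (n + 1)) \<and>
      (inv\<^bsub>F n\<^esub> p, inv\<^bsub>F (n + 1)\<^esub> q) \<in> generate ?D ?A"
    if "(p, q) \<in> generate ?D ?A" for p q
    using subgroup.m_inv_closed[OF E that] subgroup.mem_carrier[OF E that] invD by auto
  have one: "(\<one>\<^bsub>F n\<^esub>, \<one>\<^bsub>F (n + 1)\<^esub>) \<in> generate ?D ?A"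
    using subgroup.one_closed[OF E] by simp
  have "subgroup (fst ` generate ?D ?A) (F n)"
  proof (rule F1.subgroupI)
    fix p p' assume "p \<in> fst ` generate ?D ?A" "p' \<in> fst ` generate ?D ?A"
    then show "p \<otimes>\<^bsub>F n\<^esub> p' \<in> fst ` generate ?D ?A"
      using mult by force
  next
    fix p assume "p \<in> fst ` generate ?D ?A"
    then show "inv\<^bsub>F n\<^esub> p \<in> fst ` generate ?D ?A"
      using inv by force
  qed (use inv one in auto)
  \<comment> \<open>The projection contains each \<open>gen i\<close>, as
    \<open>(gen i, gen i)\<close> is an entry; hence it is onto.\<close>
  then have lift: "carrier (F n) \<subseteq> fst ` generate ?D ?A"
    by (rule subgroup_free_group_contains)
      (use gens_in_FTL_front in \<open>force intro: generate.incl\<close>)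
  let ?K = "{p. (p, \<one>\<^bsub>F (n + 1)\<^esub>) \<in> generate ?D ?A}"
  have "?K \<lhd> F n"
  proof (rule F1.normal_invI)
    show "subgroup ?K (F n)"
    proof (rule F1.subgroupI)
      fix p p' assume "p \<in> ?K" "p' \<in> ?K"
      then show "p \<otimes>\<^bsub>F n\<^esub> p' \<in> ?K"
        using mult[of p "\<one>\<^bsub>F (n + 1)\<^esub>" p' "\<one>\<^bsub>F (n + 1)\<^esub>"] by simp
    next
      fix p assume "p \<in> ?K"
      then show "inv\<^bsub>F n\<^esub> p \<in> ?K"
        using inv[of p "\<one>\<^bsub>F (n + 1)\<^esub>"] by simp
    qed (use inv one in auto)
  next
    fix w p assume "w \<in> carrier (F n)" "p \<in> ?K"
    then obtain q where q: "(w, q) \<in> generate ?D ?A"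
      using lift by force
    \<comment> \<open>Conjugating \<open>(p, 1)\<close> by \<open>(w, q)\<close> leaves the second
      coordinate trivial, whatever \<open>q\<close> is.\<close>
    have "(w \<otimes>\<^bsub>F n\<^esub> p \<otimes>\<^bsub>F n\<^esub> inv\<^bsub>F n\<^esub> w,
        q \<otimes>\<^bsub>F (n + 1)\<^esub> \<one>\<^bsub>F (n + 1)\<^esub> \<otimes>\<^bsub>F (n + 1)\<^esub> inv\<^bsub>F (n + 1)\<^esub> q) \<in> generate ?D ?A"
      using q inv[OF q] \<open>p \<in> ?K\<close> by (intro mult) auto
    then show "w \<otimes>\<^bsub>F n\<^esub> p \<otimes>\<^bsub>F n\<^esub> inv\<^bsub>F n\<^esub> w \<in> ?K"
      using inv[OF q] by simp
  qed
  moreover have "set V \<subseteq> ?K"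
    using relators_in_FTL_front by (auto intro: generate.incl)
  ultimately show ?thesis
    using normal_closure_least[of ?K "F n" "set V"] Y by auto
qed

theorem theorem4p2:
  fixes n m :: nat
    and V :: "nat letter list list"
    and a b :: "nat letter list"
    and \<iota> :: "nat letter list \<times> nat letter list \<Rightarrow> nat letter list \<times> nat letter list"
  assumes "n \<ge> 1"
    and "\<iota> \<in> mon (F n \<times>\<times> F (n + 1)) (F 2 \<times>\<times> F 2)"
    and "length V = m" and "set V \<subseteq> carrier (F n)"
    and "a \<in> carrier (F n)" and "b \<in> carrier (F n)"
  shows "hurwitz_equiv (F 2 \<times>\<times> F 2) (FTL_s1 \<iota> n V a) (FTL_s1 \<iota> n V b) \<longleftrightarrow>
    (\<exists>Y \<in> normal_closure (F n) (set V). conjugate (F n) a Y = b)"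
proof -
  let ?D = "F n \<times>\<times> F (n + 1)" and ?A = "FTL_front n V" and ?x = "gen (n + 1)"
  let ?N = "normal_closure (F n) (set V)"
  interpret F1: group "F n" by (rule group_free_group)
  interpret F2: group "F (n + 1)" by (rule group_free_group)
  interpret D: group ?D by (intro DirProd_group group_free_group)
  interpret \<iota>: group_hom ?D "F 2 \<times>\<times> F 2" \<iota>
    using assms(2)
    by (simp add: mon_def group_hom_def group_hom_axioms_def DirProd_group group_free_group)
  note V = assms(4) and a = assms(5) and b = assms(6)
  note invD = inv_DirProd[OF group_free_group group_free_group]
  have x: "?x \<in> carrier (F (n + 1))"
    by (intro gen_closed) simp
  have ax: "(a, ?x) \<in> carrier ?D" and bx: "(b, ?x) \<in> carrier ?D"
    using a b x by auto
  have N: "?N \<lhd> F n"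
    by (rule F1.normal_closure_normal[OF V])
  note NE = normal_imp_subgroup[OF N]
  have "hurwitz_equiv (F 2 \<times>\<times> F 2) (FTL_s1 \<iota> n V a) (FTL_s1 \<iota> n V b) \<longleftrightarrow>
    hurwitz_equiv ?D (?A @ [inv\<^bsub>?D\<^esub> (a, ?x), (a, ?x)]) (?A @ [inv\<^bsub>?D\<^esub> (b, ?x), (b, ?x)])"
    unfolding FTL_s1_eq[OF a] FTL_s1_eq[OF b]
    using assms(2) ax bx FTL_front_closed[OF V] D.inv_closed[OF ax] D.inv_closed[OF bx]
    by (intro \<iota>.hurwitz_equiv_map_iff) (auto simp: mon_def)
  also have "\<dots> \<longleftrightarrow> (\<exists>Y \<in> ?N. conjugate (F n) a Y = b)"
  proof
    assume "\<exists>Y \<in> ?N. conjugate (F n) a Y = b"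
    then obtain Y where Y: "Y \<in> ?N" "conjugate (F n) a Y = b" by blast
    have "Y \<in> carrier (F n)"
      using Y(1) by (rule subgroup.mem_carrier[OF NE])
    then have "conjugate ?D (a, ?x) (Y, \<one>\<^bsub>F (n + 1)\<^esub>) = (b, ?x)"
      using Y(2) x by (simp add: conjugate_def invD)
    then show "hurwitz_equiv ?D (?A @ [inv\<^bsub>?D\<^esub> (a, ?x), (a, ?x)]) (?A @ [inv\<^bsub>?D\<^esub> (b, ?x), (b, ?x)])"
      using D.hurwitz_equiv_conjugate_pair[OF normal_closure_in_generate_FTL_front[OF V Y(1)]
          FTL_front_closed[OF V] ax] by simp
  next
    assume equiv: "hurwitz_equiv ?D (?A @ [inv\<^bsub>?D\<^esub> (a, ?x), (a, ?x)]) (?A @ [inv\<^bsub>?D\<^esub> (b, ?x), (b, ?x)])"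
    \<comment> \<open>The exponent sum of the last generator; \<open>integer_group\<close> is
      additive, so its unit is 0.\<close>
    define expo where "expo = word_eval integer_group (\<lambda>i. if i = n + 1 then 1 else 0)"
    have expo_hom: "expo \<in> hom (F (n + 1)) integer_group"
      unfolding expo_def by (rule group.word_eval_hom) auto
    have expo_gen: "expo (gen i) = (if i = n + 1 then 1 else 0)" if "i \<in> {1..n + 1}" for i
      unfolding expo_def using that by (subst group.word_eval_gen[where S = "{1..n + 1}"]) auto
    interpret expo: group_hom "F (n + 1)" integer_group expo
      using expo_hom by (simp add: group_hom_def group_hom_axioms_def group_free_group)
    \<comment> \<open>Chosen so that \<open>(gen i, gen i)\<close> for \<open>i\<close> up to
      \<open>n\<close> and \<open>(a, ?x)\<close> lie on the graph of \<open>\<phi>\<close>.\<close>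
    define \<phi> where "\<phi> = word_eval (F n) (\<lambda>i. if i = n + 1 then a else gen i)"
    have f: "(\<lambda>i. if i = n + 1 then a else gen i) ` {1..n + 1} \<subseteq> carrier (F n)"
      using a by (auto intro: gen_closed)
    have \<phi>_hom: "\<phi> \<in> hom (F (n + 1)) (F n)"
      unfolding \<phi>_def by (rule F1.word_eval_hom[OF f])
    have \<phi>_gen: "\<phi> (gen i) = (if i = n + 1 then a else gen i)" if "i \<in> {1..n + 1}" for i
      unfolding \<phi>_def by (rule F1.word_eval_gen[OF f that])
    interpret \<phi>: group_hom "F (n + 1)" "F n" \<phi>
      using \<phi>_hom by (simp add: group_hom_def group_hom_axioms_def group_free_group)

    have "subgroup {c \<in> carrier ?D. (expo \<circ> snd) c = (\<lambda>_. \<one>\<^bsub>integer_group\<^esub>) c} ?D"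
      using expo_hom by (intro D.subgroup_equalizer) (auto simp: hom_def)
    then have expo_front: "expo q = 0" if "(p, q) \<in> set ?A" for p q
      using FTL_front_subset[of "{c \<in> carrier ?D. (expo \<circ> snd) c = (\<lambda>_. \<one>\<^bsub>integer_group\<^esub>) c}" n V]
        that V expo_gen by (force intro: gen_closed)

    \<comment> \<open>The condition that \<open>p\<close> lies in \<open>?N\<close> times
      \<open>\<phi> q\<close> is phrased as equality of cosets, which makes \<open>T\<close> an
      equalizer of two homomorphisms into the quotient.\<close>
    define T where "T = {c \<in> carrier ?D.
      ((\<lambda>p. ?N #>\<^bsub>F n\<^esub> p) \<circ> fst) c = ((\<lambda>p. ?N #>\<^bsub>F n\<^esub> p) \<circ> (\<phi> \<circ> snd)) c}"
    have T_iff: "(p, q) \<in> T \<longleftrightarrow> p \<in> carrier (F n) \<and> q \<in> carrier (F (n + 1)) \<and>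
      ?N #>\<^bsub>F n\<^esub> p = ?N #>\<^bsub>F n\<^esub> \<phi> q" for p q
      by (simp add: T_def)
    have T: "subgroup T ?D"
      unfolding T_def
    proof (rule D.subgroup_equalizer)
      show "group (F n Mod ?N)"
        by (rule normal.factorgroup_is_group[OF N])
      have "(\<lambda>p. ?N #>\<^bsub>F n\<^esub> p) \<in> hom (F n) (F n Mod ?N)"
        by (rule normal.r_coset_hom_Mod[OF N])
      moreover have "fst \<in> hom ?D (F n)" "\<phi> \<circ> snd \<in> hom ?D (F n)"
        using \<phi>_hom by (auto simp: hom_def)
      ultimately show "((\<lambda>p. ?N #>\<^bsub>F n\<^esub> p) \<circ> fst) \<in> hom ?D (F n Mod ?N)"
        "((\<lambda>p. ?N #>\<^bsub>F n\<^esub> p) \<circ> (\<phi> \<circ> snd)) \<in> hom ?D (F n Mod ?N)"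
        by (meson hom_compose)+
    qed
    have "set ?A \<subseteq> T"
    proof (rule FTL_front_subset[OF T V])
      fix v assume "v \<in> set V"
      then have "v \<in> ?N" "v \<in> carrier (F n)"
        using normal_closure_subset[of "set V" "F n"] V by auto
      then show "(v, \<one>\<^bsub>F (n + 1)\<^esub>) \<in> T"
        using F1.coset_join2[OF _ NE] F1.coset_join2[OF F1.one_closed NE] subgroup.one_closed[OF NE]
        by (simp add: T_iff)
    qed (use \<phi>_gen in \<open>auto simp: T_iff intro: gen_closed\<close>)
    moreover have axT: "(a, ?x) \<in> T"
      using ax \<phi>_gen[of "n + 1"] by (simp add: T_iff)
    moreover have "inv\<^bsub>?D\<^esub> (a, ?x) \<in> T"
      by (rule subgroup.m_inv_closed[OF T axT])
    ultimately have "set (?A @ [inv\<^bsub>?D\<^esub> (a, ?x), (a, ?x)]) \<subseteq> T"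
      by simp
    then have "\<exists>y \<in> set (?A @ [inv\<^bsub>?D\<^esub> (a, ?x), (a, ?x)]). \<exists>g \<in> T. (b, ?x) = conjugate ?D y g"
      by (rule D.hurwitz_equiv_conjugate[OF equiv T]) simp
    then obtain y g where y: "y \<in> set (?A @ [inv\<^bsub>?D\<^esub> (a, ?x), (a, ?x)])" and g: "g \<in> T"
      and bg: "(b, ?x) = conjugate ?D y g"
      by blast
    obtain p q where pq: "g = (p, q)" "p \<in> carrier (F n)" "q \<in> carrier (F (n + 1))"
      using g T_iff by (cases g) auto
    obtain y1 y2 where y12: "y = (y1, y2)" by force
    have yD: "y1 \<in> carrier (F n)" "y2 \<in> carrier (F (n + 1))"
      using y y12 FTL_front_closed[OF V] a x by (auto simp: invD)
    have "?x = conjugate (F (n + 1)) y2 q"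
      using bg y12 pq by (simp add: conjugate_def invD)
    \<comment> \<open>Exponent sums are invariant under conjugation because the integers are
      abelian.\<close>
    then have "expo y2 = 1"
      using expo_gen[of "n + 1"] yD pq by (auto simp: conjugate_def)
    moreover have "expo (inv\<^bsub>F (n + 1)\<^esub> ?x) = -1"
      using expo_gen[of "n + 1"] x by simp
    \<comment> \<open>The front entries have exponent 0 and the inverse entry has exponent -1, which
      leaves only this one.\<close>
    ultimately have "y = (a, ?x)"
      using y y12 expo_front a x by (auto simp: invD)
    then have xq: "?x = conjugate (F (n + 1)) ?x q" and bp: "b = conjugate (F n) a p"
      using bg pq by (simp_all add: conjugate_def invD)
    \<comment> \<open>The second coordinate of the conjugation says that \<open>q\<close> commutes
      with \<open>?x\<close>.\<close>
    have "q \<otimes>\<^bsub>F (n + 1)\<^esub> ?x = q \<otimes>\<^bsub>F (n + 1)\<^esub> conjugate (F (n + 1)) ?x q"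
      using xq by simp
    also have "\<dots> = ?x \<otimes>\<^bsub>F (n + 1)\<^esub> q"
      using x pq by (simp add: conjugate_def F2.m_assoc[symmetric])
    finally obtain k :: int where k: "q = ?x [^]\<^bsub>F (n + 1)\<^esub> k"
      using centralizer_gen[of "n + 1" "{1..n + 1}" q] pq by auto
    define c where "c = a [^]\<^bsub>F n\<^esub> k"
    have c: "c \<in> carrier (F n)"
      unfolding c_def using a by simp
    have "\<phi> q = c"
      unfolding k c_def using \<phi>.hom_int_pow[OF x] \<phi>_gen[of "n + 1"] by simp
    then have "?N #>\<^bsub>F n\<^esub> p = ?N #>\<^bsub>F n\<^esub> c"
      using g pq T_iff by simp
    then have "p \<in> ?N #>\<^bsub>F n\<^esub> c"
      using F1.rcos_self[OF pq(2) NE] by simp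
    then obtain Z where Z: "Z \<in> ?N" "p = Z \<otimes>\<^bsub>F n\<^esub> c"
      by (auto simp: r_coset_def)
    have ZE: "Z \<in> carrier (F n)"
      using Z(1) by (rule subgroup.mem_carrier[OF NE])
    \<comment> \<open>Rewriting \<open>Z\<close> times \<open>c\<close> as \<open>c\<close> times
      \<open>Y\<close> puts the power of \<open>a\<close> first, where it fixes \<open>a\<close>;
      normality keeps \<open>Y\<close> in \<open>?N\<close>.\<close>
    define Y where "Y = inv\<^bsub>F n\<^esub> c \<otimes>\<^bsub>F n\<^esub> Z \<otimes>\<^bsub>F n\<^esub> c"
    have "Y \<in> ?N"
      unfolding Y_def using normal.inv_op_closed1[OF N c Z(1)] .
    moreover have "conjugate (F n) a c = a"
    proof -
      have "a \<otimes>\<^bsub>F n\<^esub> c = c \<otimes>\<^bsub>F n\<^esub> a"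
        unfolding c_def using a by (metis F1.int_pow_1 F1.int_pow_mult add.commute)
      then show ?thesis
        using a c by (simp add: conjugate_def F1.m_assoc F1.inv_mult_cancel_left)
    qed
    moreover have "p = c \<otimes>\<^bsub>F n\<^esub> Y"
      unfolding Y_def Z(2) using c ZE by (simp add: F1.m_assoc[symmetric])
    ultimately have "conjugate (F n) a Y = b"
      using bp a c subgroup.mem_carrier[OF NE] by (simp add: F1.conjugate_mult)
    then show "\<exists>Y \<in> ?N. conjugate (F n) a Y = b"
      using \<open>Y \<in> ?N\<close> by blast
  qed
  finally show ?thesis .
qed

end
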